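(* Let $n\ge1$ be an integer and $0<p<1$. For any integer $k\ge 1$, let $Z^{(k)}_n$ be the $k$-th order generalized Zagreb index of $G(n,p)$. Then $$\mathbb{E}\big[Z^{(k)}_n\big]=\sum_{m=1}^k \genfrac\{\}{0pt}{}{k}{m}\frac{n!}{(n-m-1)!}\,p^m,$$ and $$\mathrm{Var}\big[Z^{(k)}_n\big]=n\sum_{m=1}^k\sum_{l=1}^k m!\,l!\,\genfrac\{\}{0pt}{}{k}{m}\genfrac\{\}{0pt}{}{k}{l} \bigg[(n-1)\binom{n-2}{m-1}\binom{n-2}{l-1}p^{m+l-1}(1-p) +\sum_{s=\max\{1,m+l-n+1\}}^{\min\{m,l\}} \binom{n-1}{s,\,m-s,\,l-s,\,n-m-l+s-1}\, p^{m+l-s}(1-p^s)\bigg].$$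
   Context: $G(n,p)$ is the Erdős–Rényi random graph on the vertex set $\{1,\dots,n\}$, in which each possible edge is present independently with probability $p$. $I_{ij}$ is the indicator of the event that there is an edge between $i$ and $j$ (so $I_{ii}=0$, $I_{ij}=I_{ji}$). For an integer $k\ge1$, the $k$-th order generalized Zagreb index is $Z_n^{(k)}=\sum_{i=1}^n\big(\sum_{j=1}^n I_{ij}\big)^k$, the sum of the $k$-th powers of the vertex degrees. $\genfrac\{\}{0pt}{}{k}{m}$ denotes the Stirling number of the second kind. The multinomial coefficient is $$\binom{n-1}{s,m-s,l-s,n-m-l+s-1}=\frac{(n-1)!}{s!\,(m-s)!\,(l-s)!\,(n-m-l+s-1)!}.$$ Conventions: $\frac{n!}{(n-m-1)!}$ means $n(n-1)\cdots(n-m)$ (hence $0$ when $m\ge n$), $\binom{a}{b}=0$ for integers $b>a\ge0$, a sum whose lower limit exceeds its upper limit is $0$, and for $n=1$ the term with factor $n-1=0$ is $0$. *)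

theory Defs
  imports "HOL-Probability.Probability" "HOL-Probability.Product_PMF" "HOL-Combinatorics.Stirling"
begin

definition possible_edges :: "nat \<Rightarrow> nat set set" where
  "possible_edges n = {e. e \<subseteq> {1..n} \<and> card e = 2}"

text \<open>A graph on the vertex set \<open>{1..n}\<close> is represented by its edge set, a set of
  two-element subsets of \<open>{1..n}\<close>.\<close>

definition erdos_renyi :: "nat \<Rightarrow> real \<Rightarrow> nat set set pmf" where
  "erdos_renyi n p =
     map_pmf (\<lambda>f. {e \<in> possible_edges n. f e})
       (Pi_pmf (possible_edges n) False (\<lambda>_. bernoulli_pmf p))"

text \<open>For \<open>i = j\<close> the value is 0 on every graph, since \<open>{i, i}\<close> is not a two-element set.\<close>

definition edge_indicator :: "nat set set \<Rightarrow> nat \<Rightarrow> nat \<Rightarrow> real" where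
  "edge_indicator G i j = of_bool ({i, j} \<in> G)"

definition zagreb_index :: "nat \<Rightarrow> nat \<Rightarrow> nat set set \<Rightarrow> real" where
  "zagreb_index n k G = (\<Sum>i = 1..n. (\<Sum>j = 1..n. edge_indicator G i j) ^ k)"

end

theory Submission
  imports Defs
begin

text \<open>Since \<open>d ^ k\<close> is the sum of \<open>Stirling k m * fact m * (d choose m)\<close> over \<open>m\<close>, and
  \<open>d choose m\<close> counts the \<open>m\<close>-edge stars of the graph centred at a vertex of degree \<open>d\<close>, the index is a
  linear combination of indicators of edge sets \<open>S\<close>, each with mean \<open>p ^ card S\<close>. The covariance of
  the indicators of \<open>S\<close> and \<open>S'\<close> is \<open>p ^ card (S \<union> S') - p ^ (card S + card S')\<close>. Two stars with
  the same centre are grouped by the number \<open>s\<close> of common leaves; two stars with distinct centres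
  are correlated only if each contains the other's centre, and then share exactly one edge.\<close>

section \<open>Powers as combinations of falling factorials\<close>

lemma power_eq_sum_Stirling_gbinomial:
  fixes x :: "'a::field_char_0"
  shows "x ^ k = (\<Sum>m\<le>k. of_nat (Stirling k m) * fact m * (x gchoose m))"
proof (induction k)
  case 0
  then show ?case by simp
next
  case (Suc k)
  \<comment> \<open>\<open>f m\<close> is the falling factorial
    \<open>x (x - 1) ... (x - m + 1)\<close>. Writing \<open>x = m + (x - m)\<close> in
    \<open>x * f m\<close> produces the two terms of the Stirling recurrence.\<close>
  define f where "f m = fact m * (x gchoose m)" for m
  have f: "x * f m = of_nat m * f m + f (Suc m)" for m
    using arg_cong[OF gbinomial_mult_1[of x m], of "\<lambda>y. fact m * y"] by (simp add: f_def algebra_simps)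
  have "x ^ Suc k = (\<Sum>m\<le>k. of_nat (Stirling k m) * (x * f m))"
    using Suc by (simp add: sum_distrib_left f_def mult_ac)
  also have "\<dots> = (\<Sum>m\<le>k. of_nat (m * Stirling k m) * f m) + (\<Sum>m\<le>k. of_nat (Stirling k m) * f (Suc m))"
    by (simp add: f sum.distrib algebra_simps)
  \<comment> \<open>The new top term vanishes because \<open>Stirling k (Suc k) = 0\<close>; in the
    next step the term at 0 vanishes because of its factor \<open>m\<close>. Together they allow the
    index shift.\<close>
  also have "(\<Sum>m\<le>k. of_nat (m * Stirling k m) * f m) = (\<Sum>m\<le>Suc k. of_nat (m * Stirling k m) * f m)"
    by simp
  also have "\<dots> = (\<Sum>m\<le>k. of_nat (Suc m * Stirling k (Suc m)) * f (Suc m))"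
    by (subst sum.atMost_Suc_shift) simp
  also have "\<dots> + (\<Sum>m\<le>k. of_nat (Stirling k m) * f (Suc m)) =
      (\<Sum>m\<le>Suc k. of_nat (Stirling (Suc k) m) * f m)"
    by (subst sum.atMost_Suc_shift) (simp add: sum.distrib[symmetric] algebra_simps)
  finally show ?case by (simp add: f_def mult.assoc)
qed

lemma power_eq_sum_Stirling_binomial:
  assumes "k \<ge> 1"
  shows "real d ^ k = (\<Sum>m = 1..k. real (Stirling k m) * fact m * real (d choose m))"
proof -
  have "real d ^ k = (\<Sum>m\<le>k. real (Stirling k m) * fact m * real (d choose m))"
    by (simp add: power_eq_sum_Stirling_gbinomial[of "real d"] binomial_gbinomial)
  also have "\<dots> = (\<Sum>m = 1..k. real (Stirling k m) * fact m * real (d choose m))"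
  proof (intro sum.mono_neutral_right ballI)
    fix m assume "m \<in> {..k} - {1..k}"
    then show "real (Stirling k m) * fact m * real (d choose m) = 0"
      using assms by (cases k; cases m) auto
  qed auto
  finally show ?thesis .
qed

text \<open>Absorption of the factor \<open>n\<close> into the binomial coefficient. The product is
  the form of \<open>n! / (n - m - 1)!\<close> that is 0 for \<open>m \<ge> n\<close>, since the
  factor with \<open>i = n\<close> then occurs.\<close>

lemma mult_fact_binomial_eq_prod:
  assumes "n \<ge> 1"
  shows "real n * fact m * real ((n - 1) choose m) = (\<Prod>i = 0..m. real n - real i)"
proof -
  have "real n * fact m * real ((n - 1) choose m) = fact m * (real n * ((real n - 1) gchoose m))"
    using assms by (simp add: binomial_gbinomial of_nat_diff)
  also have "\<dots> = fact (Suc m) * (real n gchoose Suc m)"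
    by (simp only: gbinomial_absorption[symmetric] fact_Suc mult_ac)
  also have "\<dots> = (\<Prod>i = 0..m. real n - real i)"
    by (simp only: gbinomial_mult_fact atLeastLessThanSuc_atLeastAtMost)
  finally show ?thesis .
qed

section \<open>Means and covariances of edge-set indicators\<close>

lemma finite_possible_edges [simp]: "finite (possible_edges n)"
  unfolding possible_edges_def by simp

lemma set_pmf_erdos_renyi: "set_pmf (erdos_renyi n p) \<subseteq> Pow (possible_edges n)"
  unfolding erdos_renyi_def by auto

text \<open>Only finitely many graphs have positive probability. As a simp rule this discharges the
  side conditions of linearity of expectation.\<close>

lemma integrable_erdos_renyi [simp]:
  fixes X :: "nat set set \<Rightarrow> real"
  shows "integrable (measure_pmf (erdos_renyi n p)) X"
  by (rule integrable_measure_pmf_finite, rule finite_subset[OF set_pmf_erdos_renyi]) simp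

text \<open>The indicator is a product over all possible edges of functions of single independent
  coordinates, with the constant 1 outside \<open>S\<close>, so its expectation factorizes.\<close>

lemma expectation_erdos_renyi_subset:
  assumes "0 \<le> p" "p \<le> 1" "S \<subseteq> possible_edges n"
  shows "measure_pmf.expectation (erdos_renyi n p) (\<lambda>G. of_bool (S \<subseteq> G)) = p ^ card S"
proof -
  let ?E = "possible_edges n"
  let ?h = "\<lambda>e b. if e \<in> S then of_bool b else (1 :: real)"
  have eq: "of_bool (S \<subseteq> {e \<in> ?E. f e}) = (\<Prod>e\<in>?E. ?h e (f e))" for f
  proof (cases "\<forall>e\<in>S. f e")
    case True
    then show ?thesis using assms(3) by (subst prod.neutral) auto
  next
    case False
    then show ?thesis using assms(3) by (subst prod_zero) auto
  qed
  have "measure_pmf.expectation (erdos_renyi n p) (\<lambda>G. of_bool (S \<subseteq> G)) =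
      measure_pmf.expectation (Pi_pmf ?E False (\<lambda>_. bernoulli_pmf p)) (\<lambda>f. \<Prod>e\<in>?E. ?h e (f e))"
    unfolding erdos_renyi_def integral_map_pmf eq ..
  also have "\<dots> = (\<Prod>e\<in>?E. measure_pmf.expectation (bernoulli_pmf p) (?h e))"
    by (rule expectation_prod_Pi_pmf) (auto intro: integrable_measure_pmf_finite)
  also have "\<dots> = (\<Prod>e\<in>?E. if e \<in> S then p else 1)"
    using assms by (intro prod.cong) auto
  also have "\<dots> = p ^ card S"
    using assms(3) by (simp add: prod.If_cases Int_absorb1)
  finally show ?thesis .
qed

text \<open>Linearity, and the fact that a product of two indicators is the indicator of the union.
  The edge sets are indexed by \<open>T\<close> rather than collected in a set, because different
  indices may give the same edge set: a one-edge star arises from both of its endpoints.\<close>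

lemma
  fixes c :: "'a \<Rightarrow> real"
  assumes p: "0 \<le> p" "p \<le> 1" and S: "\<And>x. x \<in> T \<Longrightarrow> S x \<subseteq> possible_edges n"
  defines "X \<equiv> \<lambda>G. \<Sum>x\<in>T. c x * of_bool (S x \<subseteq> G)"
  shows expectation_subgraph_count:
      "measure_pmf.expectation (erdos_renyi n p) X = (\<Sum>x\<in>T. c x * p ^ card (S x))"
    and variance_subgraph_count:
      "measure_pmf.variance (erdos_renyi n p) X =
        (\<Sum>x\<in>T. \<Sum>y\<in>T. c x * c y * (p ^ card (S x \<union> S y) - p ^ (card (S x) + card (S y))))"
proof -
  let ?M = "erdos_renyi n p"
  show E: "measure_pmf.expectation ?M X = (\<Sum>x\<in>T. c x * p ^ card (S x))"
    unfolding X_def using S p by (simp add: expectation_erdos_renyi_subset)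
  have U: "measure_pmf.expectation ?M (\<lambda>G. of_bool (S x \<subseteq> G \<and> S y \<subseteq> G)) = p ^ card (S x \<union> S y)"
    if "x \<in> T" "y \<in> T" for x y
    using expectation_erdos_renyi_subset[OF p, of "S x \<union> S y"] S that by simp
  have sq: "(X G)\<^sup>2 = (\<Sum>x\<in>T. \<Sum>y\<in>T. c x * c y * of_bool (S x \<subseteq> G \<and> S y \<subseteq> G))" for G
    unfolding X_def power2_eq_square sum_product by (intro sum.cong refl) auto
  have "measure_pmf.expectation ?M (\<lambda>G. (X G)\<^sup>2) =
      (\<Sum>x\<in>T. \<Sum>y\<in>T. c x * c y * p ^ card (S x \<union> S y))"
    unfolding sq by (simp add: U)
  moreover have "(\<Sum>x\<in>T. c x * p ^ card (S x))\<^sup>2 =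
      (\<Sum>x\<in>T. \<Sum>y\<in>T. c x * c y * p ^ (card (S x) + card (S y)))"
    unfolding power2_eq_square sum_product by (simp add: power_add mult_ac)
  ultimately show "measure_pmf.variance ?M X =
      (\<Sum>x\<in>T. \<Sum>y\<in>T. c x * c y * (p ^ card (S x \<union> S y) - p ^ (card (S x) + card (S y))))"
    by (subst measure_pmf.variance_eq) (simp_all add: E sum_subtractf right_diff_distrib)
qed

section \<open>Stars and their overlaps\<close>

definition star :: "'a \<Rightarrow> 'a set \<Rightarrow> 'a set set" where
  "star i A = (\<lambda>a. {i, a}) ` A"

lemma star_subset_possible_edges:
  assumes "i \<in> {1..n}" "A \<subseteq> {1..n} - {i}"
  shows "star i A \<subseteq> possible_edges n"
  using assms unfolding star_def possible_edges_def by (auto simp: card_insert_if)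

lemma card_star: "card (star i A) = card A"
  unfolding star_def by (rule card_image) (auto simp: inj_on_def doubleton_eq_iff)

lemma star_Un: "star i A \<union> star i B = star i (A \<union> B)"
  unfolding star_def by auto

text \<open>An edge of both stars contains both centres, so it can only be \<open>{i, j}\<close>.
  The overlap stands on the left to avoid subtraction of natural numbers.\<close>

lemma card_star_Un_star:
  assumes "i \<noteq> j" "finite A" "finite B"
  shows "card (star i A \<union> star j B) + of_bool (j \<in> A \<and> i \<in> B) = card A + card B"
proof -
  have "star i A \<inter> star j B = (if j \<in> A \<and> i \<in> B then {{i, j}} else {})"
    using assms(1) unfolding star_def by (auto simp: doubleton_eq_iff)
  then have "card (star i A \<inter> star j B) = of_bool (j \<in> A \<and> i \<in> B)"
    by simp
  moreover have "finite (star i A)" "finite (star j B)"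
    using assms unfolding star_def by auto
  ultimately show ?thesis
    using card_Un_Int[of "star i A" "star j B"] by (simp only: card_star)
qed

section \<open>Subsets of fixed size and the star expansion of the index\<close>

definition subsets_of_card :: "'a set \<Rightarrow> nat \<Rightarrow> 'a set set" where
  "subsets_of_card U m = {A. A \<subseteq> U \<and> card A = m}"

lemma finite_subsets_of_card [simp]: "finite U \<Longrightarrow> finite (subsets_of_card U m)"
  unfolding subsets_of_card_def by simp

lemma card_subsets_of_card: "finite U \<Longrightarrow> card (subsets_of_card U m) = card U choose m"
  unfolding subsets_of_card_def by (rule n_subsets)

lemma zagreb_index_eq_star_count:
  assumes G: "G \<subseteq> possible_edges n" and "k \<ge> 1"
  shows "zagreb_index n k G = (\<Sum>i = 1..n. \<Sum>m = 1..k. \<Sum>A\<in>subsets_of_card ({1..n} - {i}) m.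
    real (Stirling k m) * fact m * of_bool (star i A \<subseteq> G))"
  unfolding zagreb_index_def
proof (intro sum.cong refl)
  fix i assume i: "i \<in> {1..n}"
  define N where "N = {j \<in> {1..n}. {i, j} \<in> G}"
  \<comment> \<open>Without loops the sum over all \<open>j\<close> counts genuine neighbours only,
    so leaf sets can be taken inside \<open>{1..n} - {i}\<close>.\<close>
  have "{i, i} \<notin> G"
    using G unfolding possible_edges_def by auto
  then have N: "N \<subseteq> {1..n} - {i}"
    unfolding N_def by auto
  have "(\<Sum>j = 1..n. edge_indicator G i j) = real (card N)"
    unfolding edge_indicator_def N_def by (simp add: sum.If_cases of_bool_def Int_def)
  moreover have "real (card N choose m) =
      (\<Sum>A\<in>subsets_of_card ({1..n} - {i}) m. of_bool (star i A \<subseteq> G))" for m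
  proof -
    have "card N choose m = card {A. A \<subseteq> N \<and> card A = m}"
      using N by (subst n_subsets) (auto intro: finite_subset)
    also have "{A. A \<subseteq> N \<and> card A = m} = {A \<in> subsets_of_card ({1..n} - {i}) m. star i A \<subseteq> G}"
      using N unfolding subsets_of_card_def star_def N_def by auto
    finally show ?thesis
      by (simp add: sum.If_cases of_bool_def Int_def)
  qed
  ultimately show "(\<Sum>j = 1..n. edge_indicator G i j) ^ k = (\<Sum>m = 1..k.
      \<Sum>A\<in>subsets_of_card ({1..n} - {i}) m. real (Stirling k m) * fact m * of_bool (star i A \<subseteq> G))"
    by (simp only: power_eq_sum_Stirling_binomial[OF \<open>k \<ge> 1\<close>] sum_distrib_left)
qed

section \<open>Pairs of subsets with given intersection size\<close>

lemma card_subsets_of_card_Int: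
  assumes "finite U" "A \<subseteq> U" "s \<le> l"
  shows "card {B \<in> subsets_of_card U l. card (A \<inter> B) = s} =
    (card A choose s) * ((card U - card A) choose (l - s))"
proof -
  have fA: "finite A" using assms finite_subset by blast
  \<comment> \<open>\<open>B\<close> is determined by its parts inside and outside \<open>A\<close>,
    which can be chosen independently. The assumption \<open>s \<le> l\<close> keeps
    \<open>l - s\<close> from being truncated.\<close>
  have "bij_betw (\<lambda>B. (A \<inter> B, B - A)) {B \<in> subsets_of_card U l. card (A \<inter> B) = s}
      (subsets_of_card A s \<times> subsets_of_card (U - A) (l - s))"
  proof (rule bij_betwI[where g = "\<lambda>(C, D). C \<union> D"])
    show "(\<lambda>B. (A \<inter> B, B - A)) \<in> {B \<in> subsets_of_card U l. card (A \<inter> B) = s} \<rightarrow>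
        subsets_of_card A s \<times> subsets_of_card (U - A) (l - s)"
      using fA by (auto simp: subsets_of_card_def card_Diff_subset_Int Int_commute)
    show "(\<lambda>(C, D). C \<union> D) \<in> subsets_of_card A s \<times> subsets_of_card (U - A) (l - s) \<rightarrow>
        {B \<in> subsets_of_card U l. card (A \<inter> B) = s}"
    proof
      fix z assume "z \<in> subsets_of_card A s \<times> subsets_of_card (U - A) (l - s)"
      then obtain C D where z: "z = (C, D)" and C: "C \<subseteq> A" "card C = s"
        and D: "D \<subseteq> U - A" "card D = l - s"
        by (auto simp: subsets_of_card_def)
      have "finite C" "finite D"
        using assms fA C D finite_subset by (blast, blast)
      moreover have "C \<inter> D = {}" and "A \<inter> (C \<union> D) = C"
        using C D by auto
      ultimately show "(case z of (C, D) \<Rightarrow> C \<union> D) \<in> {B \<in> subsets_of_card U l. card (A \<inter> B) = s}"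
        using assms C D z by (auto simp: subsets_of_card_def card_Un_disjoint)
    qed
  qed (auto simp: subsets_of_card_def)
  then have "card {B \<in> subsets_of_card U l. card (A \<inter> B) = s} =
      card (subsets_of_card A s \<times> subsets_of_card (U - A) (l - s))"
    by (rule bij_betw_same_card)
  then show ?thesis
    using assms fA by (simp add: card_cartesian_product card_subsets_of_card card_Diff_subset)
qed

lemma sum_subsets_of_card_Int:
  fixes f :: "nat \<Rightarrow> real"
  assumes "finite U" "A \<subseteq> U"
  shows "(\<Sum>B\<in>subsets_of_card U l. f (card (A \<inter> B))) =
    (\<Sum>s\<le>min (card A) l. real (card A choose s) * real ((card U - card A) choose (l - s)) * f s)"
proof -
  have fA: "finite A" using assms finite_subset by blast
  have "(\<Sum>B\<in>subsets_of_card U l. f (card (A \<inter> B))) =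
      (\<Sum>s\<le>min (card A) l. \<Sum>B\<in>{B \<in> subsets_of_card U l. card (A \<inter> B) = s}. f (card (A \<inter> B)))"
    using assms fA
    by (intro sum.group[symmetric])
       (auto simp: subsets_of_card_def intro!: card_mono intro: finite_subset[OF _ assms(1)])
  also have "\<dots> = (\<Sum>s\<le>min (card A) l. real (card {B \<in> subsets_of_card U l. card (A \<inter> B) = s}) * f s)"
    by simp
  also have "\<dots> = (\<Sum>s\<le>min (card A) l.
      real (card A choose s) * real ((card U - card A) choose (l - s)) * f s)"
    using assms by (intro sum.cong refl) (simp add: card_subsets_of_card_Int)
  finally show ?thesis .
qed

text \<open>Choosing an \<open>m\<close>-set, then \<open>s\<close> of its elements, then
  \<open>l - s\<close> elements outside it splits \<open>N\<close> points into four blocks. The last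
  assumption says that the fourth block has nonnegative size.\<close>

lemma binomial_product_eq_multinomial:
  assumes "s \<le> m" "s \<le> l" "m + l \<le> N + s"
  shows "real (N choose m) * (real (m choose s) * real ((N - m) choose (l - s))) =
    fact N / (fact s * fact (m - s) * fact (l - s) * fact (N + s - (m + l)))"
proof -
  have "N - m - (l - s) = N + s - (m + l)"
    using assms by simp
  then show ?thesis
    using assms by (simp add: binomial_fact)
qed

text \<open>This is the contribution of two stars with a common centre, \<open>U\<close> being the
  set of possible leaves: their union is again a star, and its size \<open>m + l - s\<close> depends
  only on the number \<open>s\<close> of common leaves.\<close>

lemma sum_pairs_subsets_of_card:
  fixes p :: real
  assumes "finite U" "m \<ge> 1" "l \<ge> 1"
  defines "N \<equiv> card U"
  shows "(\<Sum>A\<in>subsets_of_card U m. \<Sum>B\<in>subsets_of_card U l. p ^ card (A \<union> B) - p ^ (m + l)) =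
    (\<Sum>s = max 1 (m + l - N)..min m l.
      fact N / (fact s * fact (m - s) * fact (l - s) * fact (N + s - (m + l))) *
      p ^ (m + l - s) * (1 - p ^ s))"
proof -
  let ?f = "\<lambda>s. p ^ (m + l - s) - p ^ (m + l)"
  let ?b = "\<lambda>s. real (N choose m) * (real (m choose s) * real ((N - m) choose (l - s)))"
  have "(\<Sum>B\<in>subsets_of_card U l. p ^ card (A \<union> B) - p ^ (m + l)) =
      (\<Sum>s\<le>min m l. real (m choose s) * real ((N - m) choose (l - s)) * ?f s)"
    if A: "A \<in> subsets_of_card U m" for A
  proof -
    have "p ^ card (A \<union> B) - p ^ (m + l) = ?f (card (A \<inter> B))" if "B \<in> subsets_of_card U l" for B
    proof -
      have "finite A" "finite B" "card A = m" "card B = l"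
        using A that assms(1) finite_subset by (auto simp: subsets_of_card_def)
      then have "card (A \<union> B) = m + l - card (A \<inter> B)"
        using card_Un_Int[of A B] by simp
      then show ?thesis by simp
    qed
    moreover have "A \<subseteq> U" "card A = m"
      using A by (auto simp: subsets_of_card_def)
    ultimately show ?thesis
      using sum_subsets_of_card_Int[OF assms(1), of A ?f l] by (simp add: N_def)
  qed
  then have "(\<Sum>A\<in>subsets_of_card U m. \<Sum>B\<in>subsets_of_card U l. p ^ card (A \<union> B) - p ^ (m + l)) =
      (\<Sum>s\<le>min m l. ?b s * ?f s)"
    using assms(1) by (simp add: card_subsets_of_card N_def sum_distrib_left mult.assoc)
  \<comment> \<open>For \<open>s = 0\<close> the covariance vanishes. For
    \<open>s < m + l - N\<close> the union would not fit into \<open>U\<close>, so one of the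
    binomial coefficients is 0.\<close>
  also have "\<dots> = (\<Sum>s = max 1 (m + l - N)..min m l. ?b s * ?f s)"
  proof (intro sum.mono_neutral_right ballI)
    fix s assume s: "s \<in> {..min m l} - {max 1 (m + l - N)..min m l}"
    then consider "s = 0" | "s < m + l - N" by force
    then show "?b s * ?f s = 0"
    proof cases
      case 2
      then have "N < m \<or> N - m < l - s" using s by auto
      then show ?thesis by (auto simp: binomial_eq_0)
    qed simp
  qed auto
  also have "\<dots> = (\<Sum>s = max 1 (m + l - N)..min m l.
      fact N / (fact s * fact (m - s) * fact (l - s) * fact (N + s - (m + l))) *
      p ^ (m + l - s) * (1 - p ^ s))"
  proof (intro sum.cong refl)
    fix s assume s: "s \<in> {max 1 (m + l - N)..min m l}"
    have "p ^ (m + l - s) * p ^ s = p ^ (m + l)"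
      using s by (simp flip: power_add)
    then have "?f s = p ^ (m + l - s) * (1 - p ^ s)"
      by (simp add: algebra_simps)
    then show "?b s * ?f s =
        fact N / (fact s * fact (m - s) * fact (l - s) * fact (N + s - (m + l))) *
        p ^ (m + l - s) * (1 - p ^ s)"
      using s by (subst binomial_product_eq_multinomial) auto
  qed
  finally show ?thesis .
qed

text \<open>Containing \<open>j\<close> means meeting \<open>{j}\<close> in exactly one element,
  which is a case of the intersection count.\<close>

lemma card_subsets_of_card_member:
  assumes "finite U" "j \<in> U" "m \<ge> 1"
  shows "card {A \<in> subsets_of_card U m. j \<in> A} = (card U - 1) choose (m - 1)"
proof -
  have "{A \<in> subsets_of_card U m. j \<in> A} = {B \<in> subsets_of_card U m. card ({j} \<inter> B) = 1}"
    by (auto simp: Int_insert_left split: if_splits)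
  then show ?thesis
    using card_subsets_of_card_Int[of U "{j}" 1 m] assms by simp
qed

section \<open>Covariance sums over pairs of stars\<close>

lemma sum_pairs_star_distinct_centres:
  fixes p :: real
  assumes "finite V" "i \<in> V" "j \<in> V" "i \<noteq> j" "m \<ge> 1" "l \<ge> 1"
  shows "(\<Sum>A\<in>subsets_of_card (V - {i}) m. \<Sum>B\<in>subsets_of_card (V - {j}) l.
      p ^ card (star i A \<union> star j B) - p ^ (m + l)) =
    real ((card V - 2) choose (m - 1)) * real ((card V - 2) choose (l - 1)) *
      p ^ (m + l - 1) * (1 - p)"
proof -
  let ?A = "subsets_of_card (V - {i}) m" and ?B = "subsets_of_card (V - {j}) l"
  have pw: "p ^ (m + l - 1) * p = p ^ (m + l)"
    using assms by (simp flip: power_Suc2)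
  \<comment> \<open>If the stars share an edge, their union has \<open>m + l - 1\<close> edges;
    otherwise the difference is 0. The conditions on \<open>A\<close> and \<open>B\<close> are
    separated so that the double sum factors into two counts of leaf sets with one prescribed
    member.\<close>
  have "p ^ card (star i A \<union> star j B) - p ^ (m + l) =
      of_bool (j \<in> A) * (of_bool (i \<in> B) * (p ^ (m + l - 1) * (1 - p)))"
    if "A \<in> ?A" "B \<in> ?B" for A B
  proof -
    have "finite A" "finite B" "card A = m" "card B = l"
      using that assms(1) by (auto simp: subsets_of_card_def intro: finite_subset)
    then have c: "card (star i A \<union> star j B) + of_bool (j \<in> A \<and> i \<in> B) = m + l"
      using card_star_Un_star[OF assms(4)] by simp
    show ?thesis
    proof (cases "j \<in> A \<and> i \<in> B")
      case True
      then have "card (star i A \<union> star j B) = m + l - 1" using c by simp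
      then show ?thesis using True pw by (simp add: algebra_simps)
    next
      case False
      then show ?thesis using c by auto
    qed
  qed
  then have "(\<Sum>A\<in>?A. \<Sum>B\<in>?B. p ^ card (star i A \<union> star j B) - p ^ (m + l)) =
      (\<Sum>A\<in>?A. of_bool (j \<in> A)) * ((\<Sum>B\<in>?B. of_bool (i \<in> B)) * (p ^ (m + l - 1) * (1 - p)))"
    by (simp only: sum_distrib_left[symmetric] sum_distrib_right[symmetric] cong: sum.cong)
  also have "(\<Sum>A\<in>?A. of_bool (j \<in> A)) = real ((card V - 2) choose (m - 1))"
    using assms card_subsets_of_card_member[of "V - {i}" j m]
    by (simp add: of_bool_def sum.If_cases Int_def numeral_2_eq_2)
  also have "(\<Sum>B\<in>?B. of_bool (i \<in> B)) = real ((card V - 2) choose (l - 1))"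
    using assms card_subsets_of_card_member[of "V - {j}" i l]
    by (simp add: of_bool_def sum.If_cases Int_def numeral_2_eq_2)
  finally show ?thesis by (simp add: mult.assoc)
qed

text \<open>The case \<open>j = i\<close> gives the multinomial sum, and each of the
  \<open>n - 1\<close> other centres contributes the same amount. For \<open>n = 1\<close> the
  truncated \<open>n - 2\<close> is harmless, since the factor \<open>real n - 1\<close> is
  0.\<close>

lemma sum_pairs_star:
  fixes p :: real
  assumes V: "finite V" "i \<in> V" and "m \<ge> 1" "l \<ge> 1"
  defines "n \<equiv> card V"
  shows "(\<Sum>j\<in>V. \<Sum>A\<in>subsets_of_card (V - {i}) m. \<Sum>B\<in>subsets_of_card (V - {j}) l.
      p ^ card (star i A \<union> star j B) - p ^ (m + l)) =
    (real n - 1) * real ((n - 2) choose (m - 1)) * real ((n - 2) choose (l - 1))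
        * p ^ (m + l - 1) * (1 - p)
      + (\<Sum>s = max 1 (m + l + 1 - n)..min m l.
          fact (n - 1) / (fact s * fact (m - s) * fact (l - s) * fact (n + s - (m + l + 1)))
          * p ^ (m + l - s) * (1 - p ^ s))"
proof -
  let ?F = "\<lambda>j. \<Sum>A\<in>subsets_of_card (V - {i}) m. \<Sum>B\<in>subsets_of_card (V - {j}) l.
      p ^ card (star i A \<union> star j B) - p ^ (m + l)"
  have n: "n \<ge> 1"
    using V unfolding n_def by (metis One_nat_def Suc_leI card_gt_0_iff empty_iff)
  have "(\<Sum>j\<in>V. ?F j) = ?F i + (\<Sum>j\<in>V - {i}. ?F j)"
    using V by (rule sum.remove)
  also have "(\<Sum>j\<in>V - {i}. ?F j) = (real n - 1) * (real ((n - 2) choose (m - 1)) *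
      real ((n - 2) choose (l - 1)) * p ^ (m + l - 1) * (1 - p))"
  proof -
    have "?F j = real ((n - 2) choose (m - 1)) * real ((n - 2) choose (l - 1)) *
        p ^ (m + l - 1) * (1 - p)" if "j \<in> V - {i}" for j
      using sum_pairs_star_distinct_centres[of V i j m l p] assms that by auto
    then show ?thesis
      using assms n by (simp add: of_nat_diff)
  qed
  also have "?F i = (\<Sum>s = max 1 (m + l + 1 - n)..min m l.
      fact (n - 1) / (fact s * fact (m - s) * fact (l - s) * fact (n + s - (m + l + 1)))
      * p ^ (m + l - s) * (1 - p ^ s))"
  proof -
    \<comment> \<open>There are \<open>n - 1\<close> possible leaves; \<open>n \<ge> 1\<close> makes
      the truncated subtractions agree.\<close>
    have "m + l - (n - 1) = m + l + 1 - n" "\<And>s. n - 1 + s - (m + l) = n + s - (m + l + 1)"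
      using n by auto
    then show ?thesis
      using sum_pairs_subsets_of_card[of "V - {i}" m l p] assms by (simp add: star_Un card_star)
  qed
  finally show ?thesis by (simp add: mult.assoc)
qed

section \<open>Mean and variance of the Zagreb index\<close>

theorem proposition2:
  fixes n k :: nat and p :: real
  assumes "n \<ge> 1" and "0 < p" and "p < 1" and "k \<ge> 1"
  shows
    "measure_pmf.expectation (erdos_renyi n p) (zagreb_index n k) =
       (\<Sum>m = 1..k. real (Stirling k m) * (\<Prod>i = 0..m. real n - real i) * p ^ m)
     \<and>
     measure_pmf.variance (erdos_renyi n p) (zagreb_index n k) =
       real n * (\<Sum>m = 1..k. \<Sum>l = 1..k.
         fact m * fact l * real (Stirling k m) * real (Stirling k l) *
         ((real n - 1) * real ((n - 2) choose (m - 1)) * real ((n - 2) choose (l - 1))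
             * p ^ (m + l - 1) * (1 - p)
          + (\<Sum>s = max 1 (m + l + 1 - n)..min m l.
               fact (n - 1) / (fact s * fact (m - s) * fact (l - s) * fact (n + s - (m + l + 1)))
               * p ^ (m + l - s) * (1 - p ^ s))))"
proof -
  let ?M = "erdos_renyi n p" and ?V = "{1..n}"
  let ?U = "\<lambda>i m. subsets_of_card (?V - {i}) m"
  define c where "c m = real (Stirling k m) * fact m" for m
  \<comment> \<open>Indices are triples of centre, number of leaves and leaf set. The centre is kept
    so that each edge counts as a one-leaf star at both ends.\<close>
  define T where "T = Sigma ?V (\<lambda>i. Sigma {1..k} (\<lambda>m. ?U i m))"
  define S where "S = (\<lambda>(i :: nat, m :: nat, A). star i A)"
  define X where "X = (\<lambda>G. \<Sum>x\<in>T. c (fst (snd x)) * of_bool (S x \<subseteq> G))"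
  have sum_T: "(\<Sum>x\<in>T. g x) = (\<Sum>i = 1..n. \<Sum>m = 1..k. \<Sum>A\<in>?U i m. g (i, m, A))"
    for g :: "nat \<times> nat \<times> nat set \<Rightarrow> real"
    unfolding T_def by (simp add: sum.Sigma split_def)
  have S: "S x \<subseteq> possible_edges n" if "x \<in> T" for x
  proof -
    obtain i m A where "x = (i, m, A)" "i \<in> ?V" "A \<subseteq> ?V - {i}"
      using \<open>x \<in> T\<close> unfolding T_def subsets_of_card_def by auto
    then show ?thesis
      using star_subset_possible_edges[of i n A] by (simp add: S_def)
  qed
  \<comment> \<open>The star expansion is available only for graphs with edges in
    \<open>possible_edges n\<close>; equality on the support is enough for mean and
    variance.\<close>
  have X: "zagreb_index n k G = X G" if "G \<in> set_pmf ?M" for G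
  proof -
    have "G \<subseteq> possible_edges n" using that set_pmf_erdos_renyi by blast
    then show ?thesis
      unfolding X_def sum_T using assms by (simp add: zagreb_index_eq_star_count S_def c_def)
  qed
  then have EX: "measure_pmf.expectation ?M (zagreb_index n k) = measure_pmf.expectation ?M X"
    by (intro integral_cong_AE) (auto simp: AE_measure_pmf_iff)
  have card_S: "card (star i A) = m" if "A \<in> ?U i m" for i m A
    using that by (simp add: card_star subsets_of_card_def)
  have "measure_pmf.expectation ?M X = (\<Sum>x\<in>T. c (fst (snd x)) * p ^ card (S x))"
    unfolding X_def using assms S by (intro expectation_subgraph_count) auto
  also have "\<dots> = (\<Sum>i = 1..n. \<Sum>m = 1..k. \<Sum>A\<in>?U i m. c m * p ^ m)"
    unfolding sum_T S_def by (simp add: card_S)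
  also have "\<dots> = (\<Sum>m = 1..k. real (Stirling k m) * (real n * fact m * real ((n - 1) choose m)) * p ^ m)"
    by (simp add: card_subsets_of_card sum_distrib_left c_def mult_ac)
  finally have E: "measure_pmf.expectation ?M X =
      (\<Sum>m = 1..k. real (Stirling k m) * (\<Prod>i = 0..m. real n - real i) * p ^ m)"
    using assms by (simp only: mult_fact_binomial_eq_prod)

  let ?g = "\<lambda>i j m l A B. p ^ card (star i A \<union> star j B) - p ^ (m + l)"
  have "measure_pmf.variance ?M (zagreb_index n k) = measure_pmf.variance ?M X"
    unfolding EX using X by (intro integral_cong_AE) (auto simp: AE_measure_pmf_iff)
  also have "\<dots> = (\<Sum>x\<in>T. \<Sum>y\<in>T. c (fst (snd x)) * c (fst (snd y)) *
      (p ^ card (S x \<union> S y) - p ^ (card (S x) + card (S y))))"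
    unfolding X_def using assms S by (intro variance_subgraph_count) auto
  also have "\<dots> = (\<Sum>i = 1..n. \<Sum>m = 1..k. \<Sum>A\<in>?U i m. \<Sum>j = 1..n. \<Sum>l = 1..k. \<Sum>B\<in>?U j l.
      c m * c l * ?g i j m l A B)"
    unfolding sum_T S_def by (simp add: card_S)
  \<comment> \<open>The sum over \<open>l\<close> moves outward and the sum over \<open>j\<close>
    moves in front of that over \<open>A\<close>, which isolates the triple sum of
    \<open>sum_pairs_star\<close>.\<close>
  also have "\<dots> = (\<Sum>i = 1..n. \<Sum>m = 1..k. \<Sum>l = 1..k.
      c m * c l * (\<Sum>j = 1..n. \<Sum>A\<in>?U i m. \<Sum>B\<in>?U j l. ?g i j m l A B))"
  proof (intro sum.cong refl)
    fix i m
    have "(\<Sum>A\<in>?U i m. \<Sum>j = 1..n. \<Sum>l = 1..k. \<Sum>B\<in>?U j l. c m * c l * ?g i j m l A B) =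
        (\<Sum>A\<in>?U i m. \<Sum>l = 1..k. \<Sum>j = 1..n. \<Sum>B\<in>?U j l. c m * c l * ?g i j m l A B)"
      by (intro sum.cong refl sum.swap)
    also have "\<dots> = (\<Sum>l = 1..k. \<Sum>A\<in>?U i m. \<Sum>j = 1..n. \<Sum>B\<in>?U j l. c m * c l * ?g i j m l A B)"
      by (rule sum.swap)
    also have "\<dots> = (\<Sum>l = 1..k. \<Sum>j = 1..n. \<Sum>A\<in>?U i m. \<Sum>B\<in>?U j l. c m * c l * ?g i j m l A B)"
      by (intro sum.cong refl sum.swap)
    finally show "(\<Sum>A\<in>?U i m. \<Sum>j = 1..n. \<Sum>l = 1..k. \<Sum>B\<in>?U j l. c m * c l * ?g i j m l A B) =
        (\<Sum>l = 1..k. c m * c l * (\<Sum>j = 1..n. \<Sum>A\<in>?U i m. \<Sum>B\<in>?U j l. ?g i j m l A B))"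
      by (simp only: sum_distrib_left)
  qed
  also have "\<dots> = (\<Sum>i = 1..n. \<Sum>m = 1..k. \<Sum>l = 1..k. c m * c l *
      ((real n - 1) * real ((n - 2) choose (m - 1)) * real ((n - 2) choose (l - 1))
          * p ^ (m + l - 1) * (1 - p)
        + (\<Sum>s = max 1 (m + l + 1 - n)..min m l.
            fact (n - 1) / (fact s * fact (m - s) * fact (l - s) * fact (n + s - (m + l + 1)))
            * p ^ (m + l - s) * (1 - p ^ s))))"
    by (intro sum.cong refl arg_cong2[where f = "(*)"], subst sum_pairs_star) simp_all
  \<comment> \<open>The summand no longer depends on \<open>i\<close>, so the sum over centres
    becomes the factor \<open>real n\<close>.\<close>
  finally show ?thesis
    unfolding EX E by (simp add: c_def mult_ac)
qed

end
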